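(* Let $w\ge 3$ and $\delta\ge 1$ be integers, let $\epsilon>0$, and let $N_\epsilon$ be such that $m^{\epsilon/(1+\epsilon)}\ge 1+\log_2 m$ for all $m\ge N_\epsilon$. If $m$ is an integer with $m\ge\max\{(2w)^{1+\epsilon},N_\epsilon\}$ and $2^m\le\sum_{j=0}^{w}\binom{\delta m}{j}$, then $\delta^w\ge 2^{2w-1}\sum_{j=0}^{w-1}\binom{m-w}{j}$, and an $(m,\delta m,w)$-domination mapping exists.
   Context: For $y \in \{0,1\}^n$, $\mathrm{wt}(y)$ is the number of nonzero coordinates, and $\mathcal{B}(n,w)=\{y\in\{0,1\}^n : \mathrm{wt}(y)\le w\}$. A domination graph is a bipartite graph $G=([m]\cup[n],E)$ with left vertex set $[m]$ and right vertex set $[n]$ having no isolated right vertices. An injective map $\varphi:\{0,1\}^m\to\mathcal{B}(n,w)$ is $G$-dominating if for every $x\in\{0,1\}^m$ and every edge $(i,j)\in E$: $x_i=0$ implies that the $j$-th coordinate of $\varphi(x)$ is $0$. An $(m,n,w)$-domination mapping is an injective map $\{0,1\}^m\to\mathcal{B}(n,w)$ that is $G$-dominating for some domination graph $G=([m]\cup[n],E)$. *)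

theory Defs
  imports Complex_Main "HOL-Library.FuncSet"
begin

text \<open>The index set \<open>[n]\<close> is \<open>{1..n}\<close>; a word in \<open>{0,1}\<^sup>n\<close> is an extensional function on it,
  so that equality of words is equality of their \<open>n\<close> coordinates.\<close>

definition words :: "nat \<Rightarrow> (nat \<Rightarrow> nat) set" where
  "words n = {1..n} \<rightarrow>\<^sub>E {0, 1}"

definition wt :: "nat \<Rightarrow> (nat \<Rightarrow> nat) \<Rightarrow> nat" where
  "wt n y = card {j \<in> {1..n}. y j \<noteq> 0}"

definition hamming_ball :: "nat \<Rightarrow> nat \<Rightarrow> (nat \<Rightarrow> nat) set" where
  "hamming_ball n w = {y \<in> words n. wt n y \<le> w}"

text \<open>A bipartite graph with (disjoint) left vertex set \<open>[m]\<close> and right vertex set \<open>[n]\<close> is given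
  by its edges, written as pairs (left vertex, right vertex).\<close>

definition domination_graph :: "nat \<Rightarrow> nat \<Rightarrow> (nat \<times> nat) set \<Rightarrow> bool" where
  "domination_graph m n E \<longleftrightarrow>
     E \<subseteq> {1..m} \<times> {1..n} \<and> (\<forall>j\<in>{1..n}. \<exists>i\<in>{1..m}. (i, j) \<in> E)"

definition dominating ::
    "nat \<Rightarrow> (nat \<times> nat) set \<Rightarrow> ((nat \<Rightarrow> nat) \<Rightarrow> (nat \<Rightarrow> nat)) \<Rightarrow> bool" where
  "dominating m E \<phi> \<longleftrightarrow> (\<forall>x\<in>words m. \<forall>(i, j)\<in>E. x i = 0 \<longrightarrow> \<phi> x j = 0)"

definition domination_mapping ::
    "nat \<Rightarrow> nat \<Rightarrow> nat \<Rightarrow> ((nat \<Rightarrow> nat) \<Rightarrow> (nat \<Rightarrow> nat)) \<Rightarrow> bool" where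
  "domination_mapping m n w \<phi> \<longleftrightarrow>
     \<phi> \<in> words m \<rightarrow> hamming_ball n w \<and> inj_on \<phi> (words m) \<and>
     (\<exists>E. domination_graph m n E \<and> dominating m E \<phi>)"

end

theory Submission
  imports Defs
begin

text \<open>Join the right vertices to the left ones in blocks of size \<open>\<delta>\<close>, so that every right vertex has
  degree one. A dominating map sends each \<open>X \<subseteq> [m]\<close> to a set of at most \<open>w\<close> right vertices whose
  blocks all lie in \<open>X\<close>, and by Hall's theorem it can be chosen injective if for every down-set
  \<open>D\<close> of \<open>2\<^sup>[\<^sup>m\<^sup>]\<close> we have \<open>|D| \<le> \<Sum>\<^sub>T\<^sub>\<in>\<^sub>D c |T|\<close>, where \<open>c t\<close> counts the sets of at most \<open>w\<close>
  right vertices that meet exactly \<open>t\<close> given blocks. Now \<open>c t \<ge> 1\<close> for \<open>t \<le> w\<close> and \<open>c t = 0\<close>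
  beyond, while the density of \<open>D\<close> in level \<open>t\<close> decreases with \<open>t\<close>. Comparing all densities with
  the one in level \<open>w\<close> reduces Hall's condition to the case where \<open>D\<close> is the whole cube, which is
  the hypothesis \<open>2\<^sup>m \<le> \<Sum>\<^sub>j\<^sub>\<le>\<^sub>w (\<delta>m choose j)\<close>.

  The inequality for \<open>\<delta>\<^sup>w\<close> follows from \<open>m \<ge> 2w (1 + log\<^sub>2 m)\<close>, that is, \<open>2\<^sup>m \<ge> (2m)\<^sup>2\<^sup>w\<close>.\<close>

section \<open>Hall's theorem\<close>

lemma inj_on_if_disjoint:
  assumes "inj_on f J" "inj_on g (I - J)" "f ` J \<inter> g ` (I - J) = {}"
  shows "inj_on (\<lambda>i. if i \<in> J then f i else g i) I"
proof (rule inj_onI)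
  fix i k assume "i \<in> I" "k \<in> I" "(if i \<in> J then f i else g i) = (if k \<in> J then f k else g k)"
  then show "i = k"
    using assms(3) inj_onD[OF assms(1), of i k] inj_onD[OF assms(2), of i k]
    by (cases "i \<in> J"; cases "k \<in> J") (auto simp: disjoint_iff)
qed

text \<open>Induction over proper subsets of \<open>I\<close>. If a nonempty proper subfamily
  \<open>J\<close> attains equality, match \<open>J\<close> within its union and the rest outside
  that union. Otherwise every nonempty proper subfamily has room to spare, so any one index can be
  given any of its elements.\<close>

theorem hall_marriage:
  assumes "finite I" "\<And>i. i \<in> I \<Longrightarrow> finite (S i)"
    and "\<And>J. J \<subseteq> I \<Longrightarrow> card J \<le> card (\<Union>(S ` J))"
  shows "\<exists>f. (\<forall>i\<in>I. f i \<in> S i) \<and> inj_on f I"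
  using assms
proof (induction I arbitrary: S rule: finite_psubset_induct)
  case (psubset I)
  note fin = psubset.prems(1) and hall = psubset.prems(2)
  have finU: "finite (\<Union>(S ` J))" if "J \<subseteq> I" for J
    using that psubset.hyps fin by (meson finite_UN_I finite_subset subsetD)
  consider "I = {}"
    | (tight) J where "J \<noteq> {}" "J \<subset> I" "card J = card (\<Union>(S ` J))"
    | (slack) i where "i \<in> I" "\<And>J. J \<noteq> {} \<Longrightarrow> J \<subset> I \<Longrightarrow> card J < card (\<Union>(S ` J))"
  proof (cases "\<exists>J. J \<noteq> {} \<and> J \<subset> I \<and> card J = card (\<Union>(S ` J))")
    case True
    then show ?thesis using that(2) by blast
  next
    case False
    have strict: "card J < card (\<Union>(S ` J))" if "J \<noteq> {}" "J \<subset> I" for J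
    proof -
      have "card J \<le> card (\<Union>(S ` J))" using that by (intro hall) simp
      moreover have "card J \<noteq> card (\<Union>(S ` J))" using False that by blast
      ultimately show ?thesis by simp
    qed
    show ?thesis
    proof (cases "I = {}")
      case False
      then obtain i where "i \<in> I" by blast
      then show ?thesis using strict by (rule that(3))
    qed (rule that(1))
  qed
  then show ?case
  proof cases
    case 1
    then show ?thesis by simp
  next
    case tight
    define U where "U = \<Union>(S ` J)"
    have "finite U" and "finite J"
      using finU tight(2) psubset.hyps by (auto simp: U_def intro: finite_subset)
    have "\<exists>f. (\<forall>i\<in>J. f i \<in> S i) \<and> inj_on f J"
      using tight(2) fin hall by (intro psubset.IH) auto
    then obtain f where f: "\<forall>i\<in>J. f i \<in> S i" "inj_on f J" by blast
    have "\<exists>g. (\<forall>i\<in>I - J. g i \<in> S i - U) \<and> inj_on g (I - J)"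
    proof (intro psubset.IH)
      show "I - J \<subset> I" using tight by blast
      show "finite (S i - U)" if "i \<in> I - J" for i using that fin by simp
      fix K assume K: "K \<subseteq> I - J"
      have "finite K" using K psubset.hyps by (auto intro: finite_subset)
      \<comment> \<open>Subtracting the equality for \<open>J\<close> from Hall's condition for
        \<open>K \<union> J\<close> leaves Hall's condition for \<open>K\<close> in the sets without
        \<open>U\<close>.\<close>
      have "\<Union>(S ` (K \<union> J)) = (\<Union>i\<in>K. S i - U) \<union> U" by (auto simp: U_def)
      moreover have "finite (\<Union>i\<in>K. S i - U)"
        using \<open>finite K\<close> K fin by auto
      then have "card ((\<Union>i\<in>K. S i - U) \<union> U) = card (\<Union>i\<in>K. S i - U) + card U"
        using \<open>finite U\<close> by (intro card_Un_disjoint) auto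
      ultimately have "card (\<Union>(S ` (K \<union> J))) = card (\<Union>i\<in>K. S i - U) + card U"
        by (simp only:)
      moreover have "card (K \<union> J) = card K + card J"
        using K \<open>finite K\<close> \<open>finite J\<close> by (intro card_Un_disjoint) auto
      moreover have "card (K \<union> J) \<le> card (\<Union>(S ` (K \<union> J)))"
        using K tight(2) by (intro hall) auto
      ultimately show "card K \<le> card (\<Union>i\<in>K. S i - U)"
        using tight(3) by (simp add: U_def)
    qed
    then obtain g where g: "\<forall>i\<in>I - J. g i \<in> S i - U" "inj_on g (I - J)" by blast
    have "f ` J \<inter> g ` (I - J) = {}" 
    proof -
      have "f i \<noteq> g k" if "i \<in> J" "k \<in> I - J" for i k
        using f(1) g(1) that unfolding U_def by (metis DiffD2 UN_I)
      then show ?thesis by blast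
    qed
    then have "inj_on (\<lambda>i. if i \<in> J then f i else g i) I"
      using f(2) g(2) by (intro inj_on_if_disjoint)
    moreover have "\<forall>i\<in>I. (if i \<in> J then f i else g i) \<in> S i" using f(1) g(1) by auto
    ultimately show ?thesis by (intro exI conjI)
  next
    case slack
    have "S i \<noteq> {}" using hall[of "{i}"] slack(1) by auto
    then obtain y where y: "y \<in> S i" by blast
    have "\<exists>g. (\<forall>k\<in>I - {i}. g k \<in> S k - {y}) \<and> inj_on g (I - {i})"
    proof (intro psubset.IH)
      show "I - {i} \<subset> I" using slack by blast
      show "finite (S k - {y})" if "k \<in> I - {i}" for k using that fin by simp
      fix K assume K: "K \<subseteq> I - {i}"
      show "card K \<le> card (\<Union>k\<in>K. S k - {y})"
      proof (cases "K = {}")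
        case False
        \<comment> \<open>Deleting \<open>y\<close> costs the union at most one element, which the
          strict inequality absorbs.\<close>
        then have "card K < card (\<Union>(S ` K))" using K slack by blast
        also have "\<dots> \<le> Suc (card (\<Union>k\<in>K. S k - {y}))"
        proof -
          have fin': "finite (\<Union>k\<in>K. S k - {y})"
            using K by (intro finite_subset[OF _ finU[of K]]) auto
          then have "card (\<Union>(S ` K)) \<le> card (insert y (\<Union>k\<in>K. S k - {y}))"
            by (intro card_mono) auto
          also have "\<dots> \<le> Suc (card (\<Union>k\<in>K. S k - {y}))"
            using fin' by (simp only: card_insert_if split: if_split) simp
          finally show ?thesis .
        qed
        finally show ?thesis by simp
      qed simp
    qed
    then obtain g where g: "\<forall>k\<in>I - {i}. g k \<in> S k - {y}" "inj_on g (I - {i})" by blast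
    have "inj_on (\<lambda>k. if k \<in> {i} then y else g k) I"
      using g by (intro inj_on_if_disjoint) auto
    moreover have "\<forall>k\<in>I. (if k \<in> {i} then y else g k) \<in> S k" using g(1) y by auto
    ultimately show ?thesis by (intro exI conjI)
  qed
qed

section \<open>Level densities of down-sets\<close>

lemma card_supersets_le:
  assumes "finite M" "T \<subseteq> M" "card T \<le> k"
  shows "card {X. T \<subseteq> X \<and> X \<subseteq> M \<and> card X = k} \<le> (card M - card T) choose (k - card T)"
proof -
  have "finite T" using assms finite_subset by blast
  have "card {X. T \<subseteq> X \<and> X \<subseteq> M \<and> card X = k} \<le> card {B. B \<subseteq> M - T \<and> card B = k - card T}"
  proof (rule card_inj_on_le)
    show "inj_on (\<lambda>X. X - T) {X. T \<subseteq> X \<and> X \<subseteq> M \<and> card X = k}" by (auto simp: inj_on_def)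
    show "(\<lambda>X. X - T) ` {X. T \<subseteq> X \<and> X \<subseteq> M \<and> card X = k}
      \<subseteq> {B. B \<subseteq> M - T \<and> card B = k - card T}"
      using \<open>finite T\<close> by (auto simp: card_Diff_subset)
    show "finite {B. B \<subseteq> M - T \<and> card B = k - card T}"
      using assms by (auto intro: finite_subset[of _ "Pow M"])
  qed
  also have "\<dots> = (card M - card T) choose (k - card T)"
    using assms \<open>finite T\<close> by (simp add: n_subsets card_Diff_subset)
  finally show ?thesis .
qed

text \<open>Double counting of pairs \<open>T \<subseteq> X\<close> between levels \<open>t\<close>
  and \<open>k\<close> of \<open>D\<close>: each \<open>X\<close> has all its
  \<open>t\<close>-subsets in \<open>D\<close>, while each \<open>T\<close> has at most
  \<open>(m - t) choose (k - t)\<close> supersets of size \<open>k\<close>. The densities are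
  cross-multiplied to stay in the naturals.\<close>

lemma down_set_density_antimono:
  assumes "finite M" "D \<subseteq> Pow M" and down: "\<And>X T. X \<in> D \<Longrightarrow> T \<subseteq> X \<Longrightarrow> T \<in> D"
    and "t \<le> k" "k \<le> card M"
  shows "card {X\<in>D. card X = k} * (card M choose t) \<le> card {T\<in>D. card T = t} * (card M choose k)"
proof -
  let ?X = "{X\<in>D. card X = k}" and ?T = "{T\<in>D. card T = t}" and ?m = "card M"
  have "finite D" using assms(1,2) by (auto intro: finite_subset)
  have "card ?X * (k choose t) = (\<Sum>X\<in>?X. card {T\<in>?T. T \<subseteq> X})"
  proof -
    have "card {T\<in>?T. T \<subseteq> X} = k choose t" if "X \<in> ?X" for X
    proof -
      have "{T\<in>?T. T \<subseteq> X} = {T. T \<subseteq> X \<and> card T = t}" using that down by auto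
      moreover have "finite X" using that assms by (auto intro: finite_subset)
      ultimately show ?thesis using that by (simp add: n_subsets)
    qed
    then show ?thesis by simp
  qed
  also have "\<dots> = (\<Sum>T\<in>?T. card {X\<in>?X. T \<subseteq> X})"
    using \<open>finite D\<close> by (intro sum_multicount_gen) auto
  also have "\<dots> \<le> (\<Sum>T\<in>?T. (?m - t) choose (k - t))"
  proof (rule sum_mono)
    fix T assume T: "T \<in> ?T"
    have "card {X\<in>?X. T \<subseteq> X} \<le> card {X. T \<subseteq> X \<and> X \<subseteq> M \<and> card X = k}"
      using assms by (intro card_mono) (auto intro: finite_subset[of _ "Pow M"])
    also have "\<dots> \<le> (?m - t) choose (k - t)"
      using card_supersets_le[of M T k] T assms by auto
    finally show "card {X\<in>?X. T \<subseteq> X} \<le> (?m - t) choose (k - t)" .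
  qed
  finally have "card ?X * (k choose t) \<le> card ?T * ((?m - t) choose (k - t))" by simp
  then have "card ?X * (k choose t) * (?m choose t)
      \<le> card ?T * ((?m - t) choose (k - t)) * (?m choose t)" by simp
  also have "\<dots> = card ?T * ((?m choose k) * (k choose t))"
    using choose_mult[of t k ?m] assms by (simp add: ac_simps)
  finally have "(k choose t) * (card ?X * (?m choose t)) \<le> (k choose t) * (card ?T * (?m choose k))"
    by (simp add: ac_simps)
  then show ?thesis using assms by (simp add: zero_less_binomial_iff)
qed

lemma sum_by_card:
  fixes c :: "nat \<Rightarrow> nat"
  assumes "finite M" "D \<subseteq> Pow M"
  shows "(\<Sum>X\<in>D. c (card X)) = (\<Sum>k\<le>card M. card {X\<in>D. card X = k} * c k)"
proof -
  have "finite D" using assms(1,2) by (auto intro: finite_subset)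
  then have "(\<Sum>X\<in>D. c (card X)) = (\<Sum>k\<le>card M. \<Sum>X\<in>{X\<in>D. card X = k}. c (card X))"
    using assms by (intro sum.group[symmetric]) (auto intro: card_mono)
  then show ?thesis by simp
qed

text \<open>A Chebyshev-type argument: \<open>c k - 1\<close> is nonnegative for
  \<open>k \<le> w\<close> and equals -1 beyond, while the density of level \<open>k\<close> in
  \<open>D\<close> is at least that of level \<open>w\<close> before \<open>w\<close> and at most
  that after it. Hence replacing every density by the one at \<open>w\<close> can only lower the sum
  of \<open>s k * (c k - 1)\<close>.\<close>

lemma card_down_set_le_sum_weights:
  fixes c :: "nat \<Rightarrow> nat"
  assumes "finite M" "D \<subseteq> Pow M" and down: "\<And>X T. X \<in> D \<Longrightarrow> T \<subseteq> X \<Longrightarrow> T \<in> D"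
    and c_pos: "\<And>k. k \<le> w \<Longrightarrow> c k \<ge> 1" and c_zero: "\<And>k. k > w \<Longrightarrow> c k = 0"
    and total: "2 ^ card M \<le> (\<Sum>X\<in>Pow M. c (card X))"
  shows "card D \<le> (\<Sum>X\<in>D. c (card X))"
proof -
  define m where "m = card M"
  define s where "s k = card {X\<in>D. card X = k}" for k
  \<comment> \<open>If \<open>w > m\<close> then \<open>p = 0\<close>, since the denominator vanishes; this is the bound needed then.\<close>
  define p where "p = real (s w) / real (m choose w)"
  have "p \<ge> 0" by (simp add: p_def)
  have density: "s k * (m choose t) \<le> s t * (m choose k)" if "t \<le> k" "k \<le> m" for t k
    unfolding s_def m_def
  proof (rule down_set_density_antimono[OF assms(1,2)])
    show "T \<in> D" if "X \<in> D" "T \<subseteq> X" for X T using that by (rule down)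
  qed (use that in \<open>simp_all add: m_def\<close>)
  have weighted: "p * (real (m choose k) * (real (c k) - 1)) \<le> real (s k) * (real (c k) - 1)"
    if "k \<le> m" for k
  proof (cases "k \<le> w")
    case True
    have "p * real (m choose k) \<le> real (s k)"
    proof (cases "w \<le> m")
      case wm: True
      have "s w * (m choose k) \<le> s k * (m choose w)"
        using True wm by (rule density)
      then have "real (s w) * real (m choose k) \<le> real (s k) * real (m choose w)"
        by (metis of_nat_le_iff of_nat_mult)
      then show ?thesis using wm by (simp add: p_def field_simps zero_less_binomial_iff)
    qed (simp add: p_def binomial_eq_0)
    then show ?thesis using c_pos[OF True] by (simp add: mult_right_mono flip: mult.assoc)
  next
    case False
    have "s k * (m choose w) \<le> s w * (m choose k)"
      using False that by (intro density) auto
    then have "real (s k) * real (m choose w) \<le> real (s w) * real (m choose k)"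
      by (metis of_nat_le_iff of_nat_mult)
    then show ?thesis
      using False that c_zero[of k] by (simp add: p_def field_simps zero_less_binomial_iff)
  qed
  have level: "card {X\<in>Pow M. card X = k} = m choose k" for k
    using n_subsets[OF assms(1), of k] by (simp add: m_def)
  have "2 ^ m \<le> (\<Sum>k\<le>m. (m choose k) * c k)"
    using total sum_by_card[OF assms(1), of "Pow M" c] level by (simp add: m_def)
  then have "(\<Sum>k\<le>m. m choose k) \<le> (\<Sum>k\<le>m. (m choose k) * c k)"
    by (simp add: choose_row_sum)
  then have "real (\<Sum>k\<le>m. m choose k) \<le> real (\<Sum>k\<le>m. (m choose k) * c k)"
    by (simp only: of_nat_le_iff)
  \<comment> \<open>With constant density \<open>p\<close> the claim is the one for the whole cube,
    scaled by \<open>p \<ge> 0\<close>.\<close>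
  then have "0 \<le> p * (\<Sum>k\<le>m. real (m choose k) * (real (c k) - 1))"
    using \<open>p \<ge> 0\<close> by (simp add: algebra_simps sum_subtractf mult_left_mono)
  also have "\<dots> \<le> (\<Sum>k\<le>m. real (s k) * (real (c k) - 1))"
    using weighted by (auto simp: sum_distrib_left intro: sum_mono)
  also have "\<dots> = real (\<Sum>k\<le>m. s k * c k) - real (\<Sum>k\<le>m. s k * 1)"
    by (simp add: algebra_simps sum_subtractf)
  finally have "(\<Sum>k\<le>m. s k * 1) \<le> (\<Sum>k\<le>m. s k * c k)" by linarith
  then show ?thesis
    using sum_by_card[OF assms(1,2), of c] sum_by_card[OF assms(1,2), of "\<lambda>_. 1"]
    by (simp add: s_def m_def)
qed

section \<open>Sets of bounded size over prescribed blocks\<close>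

text \<open>A right vertex is coded by its block and its position in that block. Requiring the
  projection to equal \<open>T\<close>, not merely to lie in it, makes these families disjoint for
  distinct \<open>T\<close>, so their sizes add up.\<close>

definition over :: "nat \<Rightarrow> nat \<Rightarrow> 'a set \<Rightarrow> ('a \<times> nat) set set" where
  "over d w T = {Y. Y \<subseteq> T \<times> {..<d} \<and> card Y \<le> w \<and> fst ` Y = T}"

lemma finite_over: "finite T \<Longrightarrow> finite (over d w T)"
  by (rule finite_subset[of _ "Pow (T \<times> {..<d})"]) (unfold over_def, blast, simp)

text \<open>A bijection of the blocks induces an injection of the families. One inequality suffices,
  since the hypotheses are symmetric in \<open>T\<close> and \<open>T'\<close>.\<close>

lemma card_over_le:
  assumes "finite T" "finite T'" "card T = card T'"
  shows "card (over d w T) \<le> card (over d w T')"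
proof -
  obtain h where h: "bij_betw h T T'" using assms finite_same_card_bij by blast
  let ?g = "map_prod h (id :: nat \<Rightarrow> nat)"
  have g: "inj_on ?g (T \<times> UNIV)" using h by (intro map_prod_inj_on) (auto simp: bij_betw_def)
  show ?thesis
  proof (rule card_inj_on_le)
    show "inj_on (image ?g) (over d w T)"
      by (rule inj_on_image, rule inj_on_subset[OF g]) (auto simp: over_def)
    show "image ?g ` over d w T \<subseteq> over d w T'"
    proof safe
      fix Y assume "Y \<in> over d w T"
      then have Y: "Y \<subseteq> T \<times> {..<d}" "card Y \<le> w" "fst ` Y = T" by (auto simp: over_def)
      have "card (?g ` Y) = card Y"
        using Y by (intro card_image inj_on_subset[OF g]) auto
      moreover have "?g ` Y \<subseteq> T' \<times> {..<d}" using Y(1) h by (auto simp: bij_betw_def)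
      moreover have "fst ` ?g ` Y = h ` (fst ` Y)" by force
      ultimately show "?g ` Y \<in> over d w T'" using Y h by (auto simp: over_def bij_betw_def)
    qed
    show "finite (over d w T')" using assms by (simp add: finite_over)
  qed
qed

lemma card_over_lessThan:
  "finite T \<Longrightarrow> card (over d w T) = card (over d w {..<card T})"
  by (rule antisym; rule card_over_le) simp_all

lemma card_over_pos:
  assumes "finite T" "card T \<le> w" "d \<ge> 1"
  shows "card (over d w T) \<ge> 1"
proof -
  \<comment> \<open>One vertex per block; position 0 exists because
    \<open>d \<ge> 1\<close>.\<close>
  have "T \<times> {0} \<in> over d w T" using assms by (auto simp: over_def card_cartesian_product)
  then show ?thesis
    using finite_over[OF assms(1)] by (metis One_nat_def Suc_leI card_gt_0_iff empty_iff)
qed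

lemma over_eq_empty:
  assumes "finite T" "card T > w"
  shows "over d w T = {}"
proof -
  have "card T \<le> card Y" if "Y \<subseteq> T \<times> {..<d}" "fst ` Y = T" for Y
  proof -
    have "finite Y" using that(1) by (rule finite_subset) (simp add: assms(1))
    then show ?thesis using card_image_le[of Y fst] that(2) by simp
  qed
  then have "w < card Y" if "Y \<subseteq> T \<times> {..<d}" "fst ` Y = T" for Y
    using that assms(2) order.strict_trans2 by blast
  then show ?thesis unfolding over_def using not_le by blast
qed

lemma card_UN_over:
  assumes "finite F" "\<And>T. T \<in> F \<Longrightarrow> finite T"
  shows "card (\<Union>T\<in>F. over d w T) = (\<Sum>T\<in>F. card (over d w {..<card T}))"
proof -
  have "card (\<Union>T\<in>F. over d w T) = (\<Sum>T\<in>F. card (over d w T))"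
    using assms by (intro card_UN_disjoint) (auto simp: finite_over, auto simp: over_def)
  also have "\<dots> = (\<Sum>T\<in>F. card (over d w {..<card T}))"
    using assms(2) by (intro sum.cong refl card_over_lessThan)
  finally show ?thesis .
qed

lemma card_subsets_atMost:
  assumes "finite A"
  shows "card {Y. Y \<subseteq> A \<and> card Y \<le> w} = (\<Sum>j\<le>w. card A choose j)"
proof -
  have "{Y. Y \<subseteq> A \<and> card Y \<le> w} = (\<Union>j\<le>w. {Y. Y \<subseteq> A \<and> card Y = j})" by auto
  also have "card \<dots> = (\<Sum>j\<le>w. card {Y. Y \<subseteq> A \<and> card Y = j})"
    using assms by (intro card_UN_disjoint) auto
  finally show ?thesis using assms by (simp add: n_subsets)
qed

text \<open>Hall's theorem for the sets \<open>S X\<close> of admissible images. Sorting these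
  images by the exact set of blocks they meet turns a union of sets \<open>S X\<close> into a
  disjoint union over a down-set, to which the weight inequality applies.\<close>

lemma exists_inj_small_subsets_over:
  assumes "finite M" "d \<ge> 1" "2 ^ card M \<le> (\<Sum>j\<le>w. (d * card M) choose j)"
  shows "\<exists>f. (\<forall>X\<in>Pow M. f X \<subseteq> X \<times> {..<d} \<and> card (f X) \<le> w) \<and> inj_on f (Pow M)"
proof -
  define S where "S X = {Y :: ('a \<times> nat) set. Y \<subseteq> X \<times> {..<d} \<and> card Y \<le> w}" for X
  define c where "c k = card (over d w {..<k})" for k :: nat
  have S_over: "(\<Union>(S ` A)) = (\<Union>T\<in>\<Union>(Pow ` A). over d w T)" for A
  proof (intro set_eqI iffI)
    fix Y assume "Y \<in> \<Union>(S ` A)"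
    then obtain X where X: "X \<in> A" "Y \<subseteq> X \<times> {..<d}" "card Y \<le> w" by (auto simp: S_def)
    then have "Y \<in> over d w (fst ` Y)" by (force simp: over_def)
    moreover have "fst ` Y \<subseteq> X" using X by auto
    ultimately show "Y \<in> (\<Union>T\<in>\<Union>(Pow ` A). over d w T)" using X(1) by blast
  next
    fix Y assume "Y \<in> (\<Union>T\<in>\<Union>(Pow ` A). over d w T)"
    then show "Y \<in> \<Union>(S ` A)" unfolding S_def over_def by blast
  qed
  have "2 ^ card M \<le> card (S M)"
    using assms card_subsets_atMost[of "M \<times> {..<d}" w]
    by (simp add: S_def card_cartesian_product mult.commute)
  also have "S M = (\<Union>T\<in>Pow M. over d w T)" using S_over[of "{M}"] by simp
  also have "card \<dots> = (\<Sum>T\<in>Pow M. c (card T))"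
    using assms unfolding c_def by (intro card_UN_over) (auto intro: finite_subset)
  finally have total: "2 ^ card M \<le> (\<Sum>T\<in>Pow M. c (card T))" .
  have "\<exists>f. (\<forall>X\<in>Pow M. f X \<in> S X) \<and> inj_on f (Pow M)"
  proof (rule hall_marriage)
    show "finite (Pow M)" using assms by simp
    show "finite (S X)" if "X \<in> Pow M" for X
    proof -
      have "finite X" using that assms finite_subset by blast
      then show ?thesis by (auto simp: S_def intro: finite_subset[of _ "Pow (X \<times> {..<d})"])
    qed
    fix A assume A: "A \<subseteq> Pow M"
    \<comment> \<open>Passing from \<open>A\<close> to its down-closure can only enlarge the left
      side of Hall's inequality and leaves the union of the \<open>S X\<close> unchanged.\<close>
    define D where "D = \<Union>(Pow ` A)"
    have D: "D \<subseteq> Pow M" "A \<subseteq> D" using A by (auto simp: D_def)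
    then have "finite D" using assms(1,2) by (auto intro: finite_subset)
    have "card A \<le> card D" using D \<open>finite D\<close> by (intro card_mono)
    also have "card D \<le> (\<Sum>T\<in>D. c (card T))"
    proof (rule card_down_set_le_sum_weights[OF assms(1) D(1) _ _ _ total, of w])
      show "T \<in> D" if "X \<in> D" "T \<subseteq> X" for X T using that by (auto simp: D_def)
      show "c k \<ge> 1" if "k \<le> w" for k 
        using that assms card_over_pos[of "{..<k}" w d] by (simp add: c_def)
      show "c k = 0" if "k > w" for k using that by (simp add: c_def over_eq_empty)
    qed
    also have "\<dots> = card (\<Union>(S ` A))"
      unfolding S_over c_def D_def[symmetric] 
    proof (rule card_UN_over[symmetric])
      show "finite T" if "T \<in> D" for T using that D(1) assms(1) by (meson PowD finite_subset subsetD)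
    qed (rule \<open>finite D\<close>)
    finally show "card A \<le> card (\<Union>(S ` A))" .
  qed
  then show ?thesis by (simp add: S_def)
qed

section \<open>Domination mappings\<close>

text \<open>Vertices and blocks are numbered from 1, but positions within a block from 0, hence the
  shifts around \<open>div\<close> and \<open>mod\<close>.\<close>

lemma bij_betw_blocks:
  "bij_betw (\<lambda>j. ((j - 1) div d + 1, (j - 1) mod d)) {1..d * m} ({1..m} \<times> {..<d::nat})"
proof (cases "d = 0")
  case False
  show ?thesis
  proof (rule bij_betw_byWitness[where f' = "\<lambda>(i, r). (i - 1) * d + r + 1"])
    show "(\<lambda>j. ((j - 1) div d + 1, (j - 1) mod d)) ` {1..d * m} \<subseteq> {1..m} \<times> {..<d}"
      using False by (auto simp: Suc_le_eq less_mult_imp_div_less mult.commute)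
    show "(\<lambda>(i, r). (i - 1) * d + r + 1) ` ({1..m} \<times> {..<d}) \<subseteq> {1..d * m}"
    proof safe
      fix i r assume "i \<in> {1..m}" "r < d"
      then have "(i - 1) * d + r + 1 \<le> (i - 1) * d + d" by simp
      also have "\<dots> = i * d" using \<open>i \<in> {1..m}\<close> by (cases i) auto
      also have "\<dots> \<le> d * m" using \<open>i \<in> {1..m}\<close> by simp
      finally show "(i - 1) * d + r + 1 \<in> {1..d * m}" by simp
    qed
  qed (use False in auto)
qed (simp add: bij_betw_def)

text \<open>Words correspond to their supports and right vertices, via \<open>e\<close>, to
  block-position pairs. With each vertex joined only to its own block, domination says that
  \<open>f X\<close> lies over blocks in \<open>X\<close>.\<close>

theorem exists_domination_mapping:
  assumes "d \<ge> 1" "2 ^ m \<le> (\<Sum>j\<le>w. (d * m) choose j)"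
  shows "\<exists>\<phi>. domination_mapping m (d * m) w \<phi>"
proof -
  obtain f :: "nat set \<Rightarrow> (nat \<times> nat) set" where
    f: "\<And>X. X \<subseteq> {1..m} \<Longrightarrow> f X \<subseteq> X \<times> {..<d} \<and> card (f X) \<le> w" and
    inj: "inj_on f (Pow {1..m})"
    using exists_inj_small_subsets_over[of "{1..m}" d w] assms by auto
  define e where "e j = ((j - 1) div d + 1, (j - 1) mod d)" for j :: nat
  have e: "bij_betw e {1..d * m} ({1..m} \<times> {..<d})"
    using bij_betw_blocks[of d m] by (simp add: e_def[abs_def])
  define supp where "supp x = {i\<in>{1..m}. x i \<noteq> 0}" for x :: "nat \<Rightarrow> nat"
  have supp: "supp x \<subseteq> {1..m}" for x by (auto simp: supp_def)
  define \<phi> where "\<phi> x = (\<lambda>j\<in>{1..d * m}. if e j \<in> f (supp x) then 1 else 0 :: nat)" for x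
  \<comment> \<open>The set \<open>f (supp x)\<close> is recovered from \<open>\<phi> x\<close>;
    this yields both the weight bound and injectivity.\<close>
  have f_image: "e ` {j\<in>{1..d * m}. \<phi> x j \<noteq> 0} = f (supp x)" for x
  proof -
    have "f (supp x) \<subseteq> e ` {1..d * m}"
      using f[OF supp, of x] supp[of x] e by (auto simp: bij_betw_def)
    then show ?thesis by (force simp: \<phi>_def)
  qed
  have "\<phi> x \<in> hamming_ball (d * m) w" for x
  proof -
    have "wt (d * m) (\<phi> x) = card (e ` {j\<in>{1..d * m}. \<phi> x j \<noteq> 0})"
      unfolding wt_def using e
      by (intro card_image[symmetric]) (auto simp: bij_betw_def intro: inj_on_subset)
    also have "\<dots> \<le> w" unfolding f_image using f[OF supp, of x] by simp
    finally show ?thesis by (auto simp: hamming_ball_def words_def \<phi>_def)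
  qed
  moreover have "inj_on \<phi> (words m)"
  proof (rule inj_onI)
    fix x y assume xy: "x \<in> words m" "y \<in> words m" "\<phi> x = \<phi> y"
    then have "f (supp x) = f (supp y)" by (simp flip: f_image)
    then have "supp x = supp y" using inj supp by (auto dest: inj_onD)
    show "x = y"
    proof (rule PiE_ext)
      show "x \<in> {1..m} \<rightarrow>\<^sub>E {0, 1}" "y \<in> {1..m} \<rightarrow>\<^sub>E {0, 1}" using xy by (simp_all add: words_def)
      fix i assume i: "i \<in> {1..m}"
      then have "x i \<in> {0, 1}" "y i \<in> {0, 1}" using xy by (auto simp: words_def)
      moreover have "x i \<noteq> 0 \<longleftrightarrow> y i \<noteq> 0"
        using \<open>supp x = supp y\<close> i unfolding supp_def by blast
      ultimately show "x i = y i" by auto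
    qed
  qed
  moreover have "domination_graph m (d * m) {(fst (e j), j) | j. j \<in> {1..d * m}}"
  proof -
    have "fst (e j) \<in> {1..m}" if "j \<in> {1..d * m}" for j
      using bij_betwE[OF e] that by (metis mem_Times_iff)
    then show ?thesis unfolding domination_graph_def by blast
  qed
  moreover have "dominating m {(fst (e j), j) | j. j \<in> {1..d * m}} \<phi>"
  proof -
    have "e j \<notin> f (supp x)" if "x (fst (e j)) = 0" for x j
      using that f[OF supp, of x] by (auto simp: supp_def)
    then show ?thesis by (auto simp: dominating_def \<phi>_def)
  qed
  ultimately show ?thesis unfolding domination_mapping_def by blast
qed

section \<open>The lower bound on the block size\<close>

text \<open>Termwise comparison with the binomial expansion of \<open>(n + 1) ^ w\<close>.\<close>

lemma sum_choose_le_power: "(\<Sum>j\<le>w. n choose j) \<le> (n + 1) ^ w"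
proof -
  have "(\<Sum>j\<le>w. n choose j) \<le> (\<Sum>j\<le>w. (w choose j) * n ^ j)"
  proof (rule sum_mono)
    fix j assume "j \<in> {..w}"
    then have "1 \<le> w choose j" by (simp add: Suc_le_eq zero_less_binomial_iff)
    moreover have "n choose j \<le> n ^ j"
      using binomial_le_pow[of j n] by (cases "j \<le> n") (auto simp: binomial_eq_0)
    ultimately have "1 * (n choose j) \<le> (w choose j) * n ^ j" by (rule mult_mono) auto
    then show "n choose j \<le> (w choose j) * n ^ j" by simp
  qed
  also have "\<dots> = (n + 1) ^ w" using binomial[of n 1 w] by simp
  finally show ?thesis .
qed

text \<open>Bernoulli's inequality bounds \<open>(n / (n + 1)) ^ w\<close> below by
  \<open>1 - w / (n + 1)\<close>, which is at least 1/2.\<close>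

lemma Suc_power_le_double:
  assumes "2 * w \<le> n + 1"
  shows "real (n + 1) ^ w \<le> 2 * real n ^ w"
proof -
  have "1 / 2 \<le> 1 + real w * (- 1 / real (n + 1))" using assms by (simp add: field_simps)
  also have "\<dots> \<le> (1 + (- 1 / real (n + 1))) ^ w"
    by (rule Bernoulli_inequality) (simp add: field_simps)
  also have "1 + (- 1 / real (n + 1)) = real n / real (n + 1)" by (simp add: field_simps)
  finally show ?thesis by (simp add: power_divide field_simps)
qed

text \<open>The chain \<open>(2 * m) ^ (2 * w) \<le> 2 ^ m \<le> (d * m + 1) ^ w \<le> 2 * (d * m) ^
  w\<close>, after cancelling \<open>2 * m ^ w\<close>, bounds \<open>d ^ w\<close> below by
  \<open>2 ^ (2 * w - 1) * m ^ w\<close>, and \<open>m ^ w\<close> dominates the binomial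
  sum.\<close>

theorem block_size_lower_bound:
  assumes "d \<ge> 1" "w \<ge> 1" "m \<ge> 1" and m: "real m \<ge> 2 * real w * (1 + log 2 (real m))"
    and le: "2 ^ m \<le> (\<Sum>j\<le>w. (d * m) choose j)"
  shows "d ^ w \<ge> 2 ^ (2 * w - 1) * (\<Sum>j\<le>w - 1. (m - w) choose j)"
proof -
  have "2 * real w * 1 \<le> 2 * real w * (1 + log 2 (real m))"
    using assms by (intro mult_left_mono) auto
  with m have wm: "2 * w \<le> m" by linarith
  have "(2 * real m) ^ (2 * w) = (2 * real m) powr real (2 * w)"
    using assms by (subst powr_realpow) auto
  also have "\<dots> = (2 powr (1 + log 2 (real m))) powr (2 * real w)"
    using assms by (simp add: powr_add)
  also have "\<dots> \<le> 2 powr real m" using m by (simp add: powr_powr mult.commute)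
  also have "\<dots> = real (2 ^ m)" by (simp add: powr_realpow)
  also have "\<dots> \<le> real ((d * m + 1) ^ w)"
    using le sum_choose_le_power[of "d * m" w] by (simp only: of_nat_le_iff)
  also have "\<dots> = real (d * m + 1) ^ w" by simp
  also have "\<dots> \<le> 2 * real (d * m) ^ w"
  proof (rule Suc_power_le_double)
    have "m \<le> d * m" using assms by simp
    then show "2 * w \<le> d * m + 1" using wm by linarith
  qed
  finally have "(2 * real m) ^ (2 * w) \<le> 2 * real (d * m) ^ w" .
  then have "real ((2 * m) ^ (2 * w)) \<le> real (2 * (d * m) ^ w)" by simp
  then have "(2 * m) ^ (2 * w) \<le> 2 * (d * m) ^ w" by (simp only: of_nat_le_iff)
  \<comment> \<open>The factor 2 split off here cancels the one lost to Bernoulli;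
    \<open>w \<ge> 1\<close> keeps the subtraction in the exponent from truncating.\<close>
  moreover have "(2 * m) ^ (2 * w) = 2 * 2 ^ (2 * w - 1) * m ^ w * m ^ w"
  proof -
    have "(2::nat) ^ (2 * w) = 2 * 2 ^ (2 * w - 1)" using assms(2) by (intro power_eq_if[THEN trans]) simp
    moreover have "m ^ (2 * w) = m ^ w * m ^ w" by (simp only: mult_2 power_add)
    ultimately show ?thesis by (simp only: power_mult_distrib mult.assoc)
  qed
  ultimately have "m ^ w * (2 ^ (2 * w - 1) * m ^ w) \<le> m ^ w * d ^ w"
    by (simp add: power_mult_distrib ac_simps)
  then have d: "2 ^ (2 * w - 1) * m ^ w \<le> d ^ w" using assms by simp
  have "(\<Sum>j\<le>w - 1. (m - w) choose j) \<le> (m - w + 1) ^ (w - 1)" by (rule sum_choose_le_power)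
  also have "\<dots> \<le> m ^ (w - 1)" using assms wm by (intro power_mono) auto
  also have "\<dots> \<le> m ^ w" using assms by (intro power_increasing) auto
  finally show ?thesis using d by (meson mult_le_mono2 order.trans)
qed

text \<open>The exponents \<open>1 / (1 + \<epsilon>)\<close> and
  \<open>\<epsilon> / (1 + \<epsilon>)\<close> sum to 1, so \<open>x\<close> factors into two
  powers, the first at least \<open>a\<close> and the second at least
  \<open>1 + log 2 x\<close>.\<close>

lemma linear_log_bound_of_powr_bound:
  fixes \<epsilon> x a :: real
  assumes "\<epsilon> > 0" "a \<ge> 0" "x \<ge> 1" "x \<ge> a powr (1 + \<epsilon>)" "x powr (\<epsilon> / (1 + \<epsilon>)) \<ge> 1 + log 2 x"
  shows "x \<ge> a * (1 + log 2 x)"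
proof -
  have "a = (a powr (1 + \<epsilon>)) powr (1 / (1 + \<epsilon>))" using assms by (simp add: powr_powr)
  also have "\<dots> \<le> x powr (1 / (1 + \<epsilon>))" using assms by (intro powr_mono2) auto
  finally have "a * (1 + log 2 x) \<le> x powr (1 / (1 + \<epsilon>)) * x powr (\<epsilon> / (1 + \<epsilon>))"
    using assms by (intro mult_mono) auto
  also have "\<dots> = x"
    using assms by (simp add: add_divide_distrib[symmetric] flip: powr_add)
  finally show ?thesis .
qed

theorem theorem38:
  fixes w \<delta> m :: nat and \<epsilon> N :: real
  assumes "w \<ge> 3" and "\<delta> \<ge> 1" and "\<epsilon> > 0"
    and "\<forall>k::nat. k \<ge> 1 \<and> real k \<ge> N \<longrightarrow> real k powr (\<epsilon> / (1 + \<epsilon>)) \<ge> 1 + log 2 (real k)"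
    and "real m \<ge> max ((2 * real w) powr (1 + \<epsilon>)) N"
    and "2 ^ m \<le> (\<Sum>j=0..w. (\<delta> * m) choose j)"
  shows "\<delta> ^ w \<ge> 2 ^ (2 * w - 1) * (\<Sum>j=0..w - 1. (m - w) choose j)
    \<and> (\<exists>\<phi>. domination_mapping m (\<delta> * m) w \<phi>)"
proof -
  have le: "2 ^ m \<le> (\<Sum>j\<le>w. (\<delta> * m) choose j)" using assms(6) by (simp add: atLeast0AtMost)
  \<comment> \<open>Positivity of the threshold excludes \<open>m = 0\<close>, so the hypothesis on
    \<open>N\<close> can be instantiated at \<open>m\<close>.\<close>
  have "(2 * real w) powr (1 + \<epsilon>) > 0" using assms(1) by simp
  then have "m \<ge> 1" using assms(5) by (cases m) auto
  then have "real m \<ge> 2 * real w * (1 + log 2 (real m))"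
    using assms by (intro linear_log_bound_of_powr_bound[of \<epsilon>]) auto
  then have "\<delta> ^ w \<ge> 2 ^ (2 * w - 1) * (\<Sum>j\<le>w - 1. (m - w) choose j)"
    using assms \<open>m \<ge> 1\<close> le by (intro block_size_lower_bound) auto
  then show ?thesis
    using exists_domination_mapping[OF assms(2) le] by (simp add: atLeast0AtMost)
qed

end
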